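(* For every set $\Gamma$ with $|\Gamma|\geqslant 2^{\aleph_0}$, the dual Banach space $\ell_1(\Gamma)^*$ contains a sequence $(y_n^* )_{n\in\mathbb N}$ with $\|y_n^*\|=1$ for all $n$ which converges weakly to zero (that is, in the topology $\sigma(\ell_1(\Gamma)^*,\ell_1(\Gamma)^{**})$) and such that no subsequence $(y_{n_k}^* )_{k}$, $n_1<n_2<\cdots$, is strongly normal. Consequently, it is provable in ZFC that the question "does every normal sequence in the dual of every infinite-dimensional Banach space have a strongly normal subsequence?" has a negative answer, even when restricted to weakly null normal sequences.
   Context: Banach spaces are over $\mathbb K\in\{\mathbb R,\mathbb C\}$. For a Banach space $E$, $S(E^* )$ denotes the unit sphere of the dual $E^*$. A sequence $(y_n^* )\subset S(E^* )$ is called normal if it converges to zero in the weak$^*$ topology of $E^*$. A sequence $(y_n^* )\subset S(E^* )$ is called strongly normal if the linear subspace $\{x\in E:\sum_{n=1}^\infty |y_n^*(x)|<\infty\}$ is norm dense in $E$. $\ell_1(\Gamma)$ is the Banach space of absolutely summable families of scalars indexed by $\Gamma$, with norm $\|x\|=\sum_{\gamma\in\Gamma}|x(\gamma)|$. *)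

theory Defs
  imports
    "HOL-Algebra.Module"
    "HOL-Algebra.Algebraic_Closure_Type"
    "HOL-Analysis.Analysis"
    "HOL-Library.Equipollence"
begin

text \<open>
  Duals, biduals and a quantification over all Banach spaces are needed for real and for complex
  scalars, so spaces are records with a carrier set rather than types.  The scalar field is the
  library ring \<^const>\<open>ring_of_type_algebra\<close> on a type of class \<^class>\<open>real_normed_field\<close>;
  it is used at the types \<^typ>\<open>real\<close> and \<^typ>\<open>complex\<close>.  The ring multiplication and unit that
  the record inherits from HOL-Algebra modules play no role.
\<close>

record ('k, 'v) normed_module = "('k, 'v) module" +
  nrm :: "'v \<Rightarrow> real"

locale normed_space =
  Module.module "ring_of_type_algebra :: 'k ring" E
  for E :: "('k::real_normed_field, 'v) normed_module" (structure) +
  assumes nrm_eq_0_iff: "x \<in> carrier E \<Longrightarrow> nrm E x = 0 \<longleftrightarrow> x = \<zero>"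
    and nrm_smult: "x \<in> carrier E \<Longrightarrow> nrm E (c \<odot>\<^bsub>E\<^esub> x) = norm c * nrm E x"
    and nrm_triangle: "x \<in> carrier E \<Longrightarrow> y \<in> carrier E \<Longrightarrow> nrm E (x \<oplus> y) \<le> nrm E x + nrm E y"

text \<open>The library locale \<^locale>\<open>Metric_space\<close> wants symmetry and nonnegativity also off the carrier.\<close>

definition ndist :: "('k::real_normed_field, 'v) normed_module \<Rightarrow> 'v \<Rightarrow> 'v \<Rightarrow> real" where
  "ndist E x y = (if x \<in> carrier E \<and> y \<in> carrier E then nrm E (x \<ominus>\<^bsub>E\<^esub> y) else 0)"

definition norm_topology :: "('k::real_normed_field, 'v) normed_module \<Rightarrow> 'v topology" where
  "norm_topology E = Metric_space.mtopology (carrier E) (ndist E)"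

definition banach_space :: "('k::real_normed_field, 'v) normed_module \<Rightarrow> bool" where
  "banach_space E \<longleftrightarrow> normed_space E \<and> Metric_space.mcomplete (carrier E) (ndist E)"

definition infinite_dimensional :: "('k::real_normed_field, 'v) normed_module \<Rightarrow> bool" where
  "infinite_dimensional E \<longleftrightarrow>
     \<not> (\<exists>B. finite B \<and> B \<subseteq> carrier E \<and>
          carrier E = \<Inter> {H. submodule H (ring_of_type_algebra :: 'k ring) E \<and> B \<subseteq> H})"

text \<open>
  A space of scalar functions with pointwise operations.  Functions on a set are represented by
  functions on the whole type that vanish off this set.
\<close>

definition function_space ::
  "('i \<Rightarrow> 'k) set \<Rightarrow> (('i \<Rightarrow> 'k) \<Rightarrow> real) \<Rightarrow> ('k::real_normed_field, 'i \<Rightarrow> 'k) normed_module" where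
  "function_space V N =
     \<lparr> carrier = V, monoid.mult = (\<lambda>x y i. x i * y i), one = (\<lambda>i. 1),
       zero = (\<lambda>i. 0), add = (\<lambda>x y i. x i + y i), module.smult = (\<lambda>c x i. c * x i), nrm = N \<rparr>"

definition l1_space :: "'g set \<Rightarrow> ('k::real_normed_field, 'g \<Rightarrow> 'k) normed_module" where
  "l1_space \<Gamma> =
     function_space {x. (\<lambda>\<gamma>. norm (x \<gamma>)) summable_on \<Gamma> \<and> (\<forall>\<gamma>. \<gamma> \<notin> \<Gamma> \<longrightarrow> x \<gamma> = 0)}
       (\<lambda>x. \<Sum>\<^sub>\<infinity>\<gamma>\<in>\<Gamma>. norm (x \<gamma>))"

definition bounded_functional ::
  "('k::real_normed_field, 'v) normed_module \<Rightarrow> ('v \<Rightarrow> 'k) \<Rightarrow> bool" where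
  "bounded_functional E f \<longleftrightarrow>
     (\<forall>x\<in>carrier E. \<forall>y\<in>carrier E. f (x \<oplus>\<^bsub>E\<^esub> y) = f x + f y) \<and>
     (\<forall>c. \<forall>x\<in>carrier E. f (c \<odot>\<^bsub>E\<^esub> x) = c * f x) \<and>
     (\<exists>C. \<forall>x\<in>carrier E. norm (f x) \<le> C * nrm E x)"

definition dual_space ::
  "('k::real_normed_field, 'v) normed_module \<Rightarrow> ('k, 'v \<Rightarrow> 'k) normed_module" where
  "dual_space E =
     function_space {f. bounded_functional E f \<and> (\<forall>x. x \<notin> carrier E \<longrightarrow> f x = 0)}
       (\<lambda>f. SUP x\<in>{x \<in> carrier E. nrm E x \<le> 1}. norm (f x))"

definition unit_sphere :: "('k::real_normed_field, 'v) normed_module \<Rightarrow> 'v set" where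
  "unit_sphere E = {x \<in> carrier E. nrm E x = 1}"

definition initial_topology :: "'x set \<Rightarrow> ('x \<Rightarrow> 'k::topological_space) set \<Rightarrow> 'x topology" where
  "initial_topology S F = topology_generated_by {{x \<in> S. f x \<in> U} | f U. f \<in> F \<and> open U}"

definition weak_topology :: "('k::real_normed_field, 'v) normed_module \<Rightarrow> 'v topology" where
  "weak_topology E = initial_topology (carrier E) (carrier (dual_space E))"

definition weak_star_topology ::
  "('k::real_normed_field, 'v) normed_module \<Rightarrow> ('v \<Rightarrow> 'k) topology" where
  "weak_star_topology E =
     initial_topology (carrier (dual_space E)) ((\<lambda>x f. f x) ` carrier E)"

definition weakly_null :: "('k::real_normed_field, 'v) normed_module \<Rightarrow> (nat \<Rightarrow> 'v) \<Rightarrow> bool" where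
  "weakly_null E x \<longleftrightarrow> limitin (weak_topology E) x \<zero>\<^bsub>E\<^esub> sequentially"

definition normal_seq ::
  "('k::real_normed_field, 'v) normed_module \<Rightarrow> (nat \<Rightarrow> 'v \<Rightarrow> 'k) \<Rightarrow> bool" where
  "normal_seq E y \<longleftrightarrow>
     (\<forall>n. y n \<in> unit_sphere (dual_space E)) \<and>
     limitin (weak_star_topology E) y \<zero>\<^bsub>dual_space E\<^esub> sequentially"

definition strongly_normal_seq ::
  "('k::real_normed_field, 'v) normed_module \<Rightarrow> (nat \<Rightarrow> 'v \<Rightarrow> 'k) \<Rightarrow> bool" where
  "strongly_normal_seq E y \<longleftrightarrow>
     (\<forall>n. y n \<in> unit_sphere (dual_space E)) \<and>
     norm_topology E closure_of {x \<in> carrier E. summable (\<lambda>n. norm (y n x))} = carrier E"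

definition has_strongly_normal_subseq ::
  "('k::real_normed_field, 'v) normed_module \<Rightarrow> (nat \<Rightarrow> 'v \<Rightarrow> 'k) \<Rightarrow> bool" where
  "has_strongly_normal_subseq E y \<longleftrightarrow>
     (\<exists>r :: nat \<Rightarrow> nat. strict_mono r \<and> strongly_normal_seq E (y \<circ> r))"

end

theory Submission
  imports Defs
begin

text \<open>
  Let every element \<open>\<gamma>\<close> of \<open>\<Gamma>\<close> stand for a set \<open>A \<gamma>\<close> of natural numbers, so that every set of
  naturals occurs; this is where the cardinality of the continuum enters.  Let the functional
  \<open>y n\<close> send the unit vector at \<open>\<gamma>\<close> to \<open>1/k\<close> if \<open>n\<close> is the \<open>k\<close>-th element of \<open>A \<gamma>\<close>, and to 0 if
  \<open>n\<close> is not in \<open>A \<gamma>\<close>.  Write \<open>H m = 1 + 1/2 + \<dots> + 1/m\<close>.  Any \<open>m\<close> distinct elements of a set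
  have distinct ranks, hence the values at one unit vector of any \<open>m\<close> of the functionals sum to
  at most \<open>H m\<close>, and therefore \<open>\<Sum>n\<in>F. \<bar>y n x\<bar> \<le> H (card F) * \<parallel>x\<parallel>\<close> for every finite \<open>F\<close> and every \<open>x\<close>
  (lemma \<open>sum_norm_rank_functional_le\<close>).  This one estimate is used twice.

  Weak convergence.  For a functional \<open>\<phi>\<close> on the dual, choose scalars \<open>s n\<close> of modulus 1 with
  \<open>s n * \<phi> (y n) = \<bar>\<phi> (y n)\<bar>\<close>.  The estimate bounds the norm of \<open>\<Sum>n\<in>F. s n * y n\<close> by \<open>H (card F)\<close>,
  so \<open>\<Sum>n\<in>F. \<bar>\<phi> (y n)\<bar> \<le> \<parallel>\<phi>\<parallel> * H (card F)\<close>.  Since \<open>H m / m\<close> tends to 0, only finitely many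
  \<open>\<bar>\<phi> (y n)\<bar>\<close> can exceed a given \<open>\<epsilon> > 0\<close> (lemma \<open>weakly_null_if_sums_le_harm\<close>).

  No strongly normal subsequence.  Given \<open>r 0 < r 1 < \<dots>\<close>, choose \<open>\<gamma>\<close> with \<open>A \<gamma> = range r\<close> and let
  \<open>e\<close> be the unit vector at \<open>\<gamma>\<close>.  Then \<open>y (r k) e = 1/(k+1)\<close>.  If \<open>\<parallel>e - x\<parallel> = d < 1\<close>, the
  estimate applied to \<open>e - x\<close> gives \<open>\<Sum>k<m. \<bar>y (r k) x\<bar> \<ge> (1 - d) * H m\<close>, which is unbounded.  So the
  subspace of absolute summability misses an open ball (lemma \<open>not_summable_rank_functional\<close>).

  For the negative answer to the question about all Banach spaces, the space is taken over the
  power set of the naturals.  It is complete, and it is infinite-dimensional because in a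
  finite-dimensional space every normal sequence has a strongly normal subsequence
  (lemma \<open>infinite_dimensional_if_no_strongly_normal_subseq\<close>).
\<close>

section \<open>Reciprocal ranks and harmonic growth\<close>

text \<open>
  The smallest element of \<open>A\<close> has rank 1, so the values on \<open>A\<close>, in increasing order, are
  \<open>1, 1/2, 1/3, \<dots>\<close>.  The partial sums of this sequence are unbounded but grow more slowly
  than the number of terms: the former prevents density, the latter gives weak convergence.
\<close>

definition reciprocal_rank :: "nat set \<Rightarrow> nat \<Rightarrow> real" where
  "reciprocal_rank A n = (if n \<in> A then 1 / real (card {m \<in> A. m \<le> n}) else 0)"

lemma reciprocal_rank_nonneg: "0 \<le> reciprocal_rank A n"
  by (simp add: reciprocal_rank_def)

lemma reciprocal_rank_le_1: "reciprocal_rank A n \<le> 1"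
proof (cases "n \<in> A")
  case True
  then have "card {m \<in> A. m \<le> n} > 0"
    by (auto simp: card_gt_0_iff)
  then show ?thesis
    by (simp add: reciprocal_rank_def)
qed (simp add: reciprocal_rank_def)

lemma reciprocal_rank_range:
  assumes "strict_mono r"
  shows "reciprocal_rank (range r) (r k) = 1 / real (Suc k)"
proof -
  have "{m \<in> range r. m \<le> r k} = r ` {..k}"
    using assms by (auto simp: strict_mono_less_eq)
  then have "card {m \<in> range r. m \<le> r k} = Suc k"
    using assms by (simp add: card_image strict_mono_imp_inj_on inj_on_subset)
  then show ?thesis
    by (simp add: reciprocal_rank_def)
qed

text \<open>
  A set with \<open>m\<close> elements collects at most \<open>1 + 1/2 + \<dots> + 1/m\<close>, with equality when \<open>F\<close>
  consists of the \<open>m\<close> smallest elements of \<open>A\<close>.  The bound is the same for all \<open>A\<close>, so a set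
  \<open>A\<close> carries along its own initial segments at least as much weight as every other set does;
  both weak convergence and the failure of density come from this.
\<close>

lemma sum_reciprocal_rank_le_harm:
  assumes "finite F"
  shows "(\<Sum>n\<in>F. reciprocal_rank A n) \<le> harm (card F)"
proof -
  \<comment> \<open>When a new maximum \<open>n \<in> A\<close> is added to \<open>F\<close>, its rank in \<open>A\<close> exceeds the number of elements of \<open>A \<inter> F\<close>.\<close>
  have "(\<Sum>n\<in>F. reciprocal_rank A n) \<le> harm (card (A \<inter> F))"
    using assms
  proof (induction F rule: finite_linorder_max_induct)
    case empty
    then show ?case by (simp add: harm_def)
  next
    case (insert n F)
    show ?case
    proof (cases "n \<in> A")
      case True
      have "n \<notin> F" using insert by auto
      have "insert n (A \<inter> F) \<subseteq> {m \<in> A. m \<le> n}"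
        using insert True by auto
      then have "card (insert n (A \<inter> F)) \<le> card {m \<in> A. m \<le> n}"
        by (intro card_mono) auto
      then have "Suc (card (A \<inter> F)) \<le> card {m \<in> A. m \<le> n}"
        using insert \<open>n \<notin> F\<close> by simp
      then have "reciprocal_rank A n \<le> 1 / real (Suc (card (A \<inter> F)))"
        using True unfolding reciprocal_rank_def by (auto intro!: divide_left_mono)
      then show ?thesis
        using insert True \<open>n \<notin> F\<close> by (simp add: harm_Suc inverse_eq_divide)
    next
      case False
      then show ?thesis
        using insert by (auto simp: reciprocal_rank_def)
    qed
  qed
  also have "\<dots> \<le> harm (card F)"
    using assms by (intro harm_mono card_mono) auto
  finally show ?thesis .
qed

lemma harm_over_n_tendsto_0: "(\<lambda>n. harm n / real n) \<longlonglongrightarrow> 0"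
proof -
  have "(\<lambda>n. (harm n - ln (real n)) * (1 / real n) + ln (real n) / real n) \<longlonglongrightarrow>
          euler_mascheroni * 0 + 0"
    by (intro tendsto_add tendsto_mult euler_mascheroni_LIMSEQ lim_1_over_n lim_ln_over_n)
  then show ?thesis
    by (simp add: diff_divide_distrib)
qed

text \<open>
  If infinitely many norms were at least \<open>\<epsilon>\<close>, sums over \<open>m\<close> of them would grow linearly in
  \<open>m\<close>, whereas the harmonic numbers are \<open>o(m)\<close>.
\<close>

lemma tendsto_0_if_sums_le_harm:
  fixes a :: "nat \<Rightarrow> 'a::real_normed_vector"
  assumes le: "\<And>F. finite F \<Longrightarrow> (\<Sum>n\<in>F. norm (a n)) \<le> C * harm (card F)"
  shows "a \<longlonglongrightarrow> 0"
proof (rule ccontr)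
  assume "\<not> a \<longlonglongrightarrow> 0"
  then obtain \<epsilon> where \<epsilon>: "\<epsilon> > 0" and inf: "infinite {n. \<epsilon> \<le> norm (a n)}"
    by (auto simp: tendsto_iff eventually_sequentially infinite_nat_iff_unbounded_le not_less)
  have "\<epsilon> \<le> C * (harm m / real m)" if "m > 0" for m
  proof -
    obtain F where F: "finite F" "card F = m" "F \<subseteq> {n. \<epsilon> \<le> norm (a n)}"
      using infinite_arbitrarily_large[OF inf] by blast
    then have "real m * \<epsilon> \<le> (\<Sum>n\<in>F. norm (a n))"
      using sum_bounded_below[of F \<epsilon> "\<lambda>n. norm (a n)"] by auto
    also have "\<dots> \<le> C * harm m"
      using le F by blast
    finally show ?thesis
      using that by (simp add: field_simps)
  qed
  moreover have "(\<lambda>m. C * (harm m / real m)) \<longlonglongrightarrow> C * 0"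
    by (intro tendsto_mult tendsto_const harm_over_n_tendsto_0)
  ultimately have "\<epsilon> \<le> C * 0"
    by (intro tendsto_lowerbound[of "\<lambda>m. C * (harm m / real m)" _ sequentially])
       (auto simp: eventually_sequentially intro!: exI[of _ 1])
  with \<epsilon> show False by simp
qed

section \<open>Normed spaces and their duals\<close>

lemma ring_of_type_algebra_simps [simp]:
  "carrier ring_of_type_algebra = UNIV"
  "\<zero>\<^bsub>ring_of_type_algebra\<^esub> = 0"
  "\<one>\<^bsub>ring_of_type_algebra\<^esub> = 1"
  "a \<oplus>\<^bsub>ring_of_type_algebra\<^esub> b = a + b"
  "a \<otimes>\<^bsub>ring_of_type_algebra\<^esub> b = a * b"
  by (simp_all add: ring_of_type_algebra_def)

lemma function_space_simps [simp]:
  "carrier (function_space V N) = V"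
  "\<zero>\<^bsub>function_space V N\<^esub> = (\<lambda>i. 0)"
  "x \<oplus>\<^bsub>function_space V N\<^esub> y = (\<lambda>i. x i + y i)"
  "c \<odot>\<^bsub>function_space V N\<^esub> x = (\<lambda>i. c * x i)"
  "nrm (function_space V N) x = N x"
  by (simp_all add: function_space_def)

lemma ring_of_type_algebra_neg_one [simp]:
  "\<ominus>\<^bsub>ring_of_type_algebra\<^esub> 1 = (- 1 :: 'k::real_normed_field)"
proof -
  interpret cring "ring_of_type_algebra :: 'k ring"
    by (rule cring_from_type_algebra)
  show ?thesis
    by (rule minus_equality) auto
qed

context normed_space
begin

lemma a_inv_eq_smult: "x \<in> carrier E \<Longrightarrow> \<ominus> x = (- 1) \<odot> x"
  using smult_l_minus[of 1 x] smult_one[of x] by simp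

lemma nrm_zero: "nrm E \<zero> = 0"
  by (simp add: nrm_eq_0_iff)

lemma nrm_a_inv: "x \<in> carrier E \<Longrightarrow> nrm E (\<ominus> x) = nrm E x"
  by (simp add: a_inv_eq_smult nrm_smult)

lemma nrm_nonneg:
  assumes "x \<in> carrier E"
  shows "0 \<le> nrm E x"
proof -
  have "nrm E (x \<oplus> (\<ominus> x)) \<le> nrm E x + nrm E x"
    using nrm_triangle[of x "\<ominus> x"] nrm_a_inv assms by simp
  then show ?thesis
    using assms by (simp add: M.r_neg nrm_zero)
qed

lemma Metric_space_ndist: "Metric_space (carrier E) (ndist E)"
proof
  show "0 \<le> ndist E x y" for x y
    by (simp add: ndist_def nrm_nonneg)
  show "ndist E x y = ndist E y x" for x y
  proof (cases "x \<in> carrier E \<and> y \<in> carrier E")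
    case True
    then have "y \<ominus> x = \<ominus> (x \<ominus> y)"
      by (simp add: M.minus_add M.a_comm a_minus_def)
    then show ?thesis
      using True nrm_a_inv[of "x \<ominus> y"] by (simp add: ndist_def)
  qed (auto simp: ndist_def)
  show "ndist E x y = 0 \<longleftrightarrow> x = y" if "x \<in> carrier E" "y \<in> carrier E" for x y
  proof -
    have "x \<ominus> y = \<zero> \<longleftrightarrow> x = y"
      using that by (metis M.a_inv_closed M.minus_equality M.minus_minus M.r_neg a_minus_def)
    then show ?thesis
      using that by (simp add: ndist_def nrm_eq_0_iff)
  qed
  show "ndist E x z \<le> ndist E x y + ndist E y z"
    if "x \<in> carrier E" "y \<in> carrier E" "z \<in> carrier E" for x y z
  proof -
    have "x \<ominus> z = (x \<ominus> y) \<oplus> (y \<ominus> z)"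
      using that by (simp add: a_minus_def M.a_assoc M.r_neg1)
    then show ?thesis
      using that nrm_triangle[of "x \<ominus> y" "y \<ominus> z"] by (simp add: ndist_def)
  qed
qed

end

text \<open>
  The set \<open>F\<close> has to be nonempty because the generating sets cover \<open>S\<close> only if there is
  a function in \<open>F\<close>.
\<close>

lemma limitin_initial_topology_iff:
  assumes "F \<noteq> {}"
  shows "limitin (initial_topology S F) x l G \<longleftrightarrow>
    l \<in> S \<and> eventually (\<lambda>n. x n \<in> S) G \<and> (\<forall>f\<in>F. ((\<lambda>n. f (x n)) \<longlongrightarrow> f l) G)"
proof -
  define B where "B = {{x \<in> S. f x \<in> U} | f U. f \<in> F \<and> open U}"
  have "{x \<in> S. f x \<in> UNIV} \<in> B" if "f \<in> F" for f
    unfolding B_def using that open_UNIV by blast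
  then have S: "S \<in> B" and top: "\<Union>B = S"
    using assms by (auto simp: B_def)
  have open_iff: "openin (initial_topology S F) U \<longleftrightarrow> generate_topology_on B U" for U
    unfolding initial_topology_def B_def openin_topology_generated_by_iff ..
  show ?thesis
  proof
    assume lim: "limitin (initial_topology S F) x l G"
    have ev: "eventually (\<lambda>n. x n \<in> U) G" if "U \<in> B" "l \<in> U" for U
      using lim that generate_topology_on.Basis unfolding limitin_def open_iff by metis
    have "l \<in> S"
      using lim top unfolding limitin_def initial_topology_def B_def by simp
    moreover have "((\<lambda>n. f (x n)) \<longlongrightarrow> f l) G" if "f \<in> F" for f
    proof (rule topological_tendstoI)
      fix U assume U: "open U" "f l \<in> U"
      then have "eventually (\<lambda>n. x n \<in> {x \<in> S. f x \<in> U}) G"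
        using \<open>f \<in> F\<close> \<open>l \<in> S\<close> by (intro ev) (auto simp: B_def)
      then show "eventually (\<lambda>n. f (x n) \<in> U) G"
        by eventually_elim auto
    qed
    ultimately show "l \<in> S \<and> eventually (\<lambda>n. x n \<in> S) G \<and>
        (\<forall>f\<in>F. ((\<lambda>n. f (x n)) \<longlongrightarrow> f l) G)"
      using ev[OF S] by blast
  next
    assume rhs: "l \<in> S \<and> eventually (\<lambda>n. x n \<in> S) G \<and>
        (\<forall>f\<in>F. ((\<lambda>n. f (x n)) \<longlongrightarrow> f l) G)"
    have "l \<in> U \<longrightarrow> eventually (\<lambda>n. x n \<in> U) G" if "generate_topology_on B U" for U
      using that
    proof induction
      case (Int a b)
      then show ?case by (auto simp: eventually_conj_iff)
    next
      case (UN K)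
      show ?case
      proof
        assume "l \<in> \<Union>K"
        then obtain k where "k \<in> K" "eventually (\<lambda>n. x n \<in> k) G"
          using UN by blast
        then show "eventually (\<lambda>n. x n \<in> \<Union>K) G"
          by (auto elim: eventually_mono)
      qed
    next
      case (Basis s)
      then obtain f V where s: "s = {x \<in> S. f x \<in> V}" and fV: "f \<in> F" "open V"
        unfolding B_def by blast
      show ?case
      proof
        assume "l \<in> s"
        then have "eventually (\<lambda>n. f (x n) \<in> V) G"
          using rhs s fV by (auto intro: topological_tendstoD)
        moreover have "eventually (\<lambda>n. x n \<in> S) G"
          using rhs by blast
        ultimately show "eventually (\<lambda>n. x n \<in> s) G"
          by eventually_elim (simp add: s)
      qed
    qed simp
    then show "limitin (initial_topology S F) x l G"
      using rhs top unfolding limitin_def open_iff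
      by (auto simp: initial_topology_def B_def)
  qed
qed

lemma dual_space_simps [simp]:
  "\<zero>\<^bsub>dual_space E\<^esub> = (\<lambda>x. 0)"
  "f \<oplus>\<^bsub>dual_space E\<^esub> g = (\<lambda>x. f x + g x)"
  "c \<odot>\<^bsub>dual_space E\<^esub> f = (\<lambda>x. c * f x)"
  by (simp_all add: dual_space_def)

lemma carrier_dual_space:
  "f \<in> carrier (dual_space E) \<longleftrightarrow> bounded_functional E f \<and> (\<forall>x. x \<notin> carrier E \<longrightarrow> f x = 0)"
  by (simp add: dual_space_def)

lemma nrm_dual_space:
  "nrm (dual_space E) f = (SUP x\<in>{x \<in> carrier E. nrm E x \<le> 1}. norm (f x))"
  by (simp add: dual_space_def)

lemma dual_space_boundE:
  assumes "f \<in> carrier (dual_space E)"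
  obtains C where "\<And>x. x \<in> carrier E \<Longrightarrow> norm (f x) \<le> C * nrm E x"
  using assms unfolding carrier_dual_space bounded_functional_def by blast

lemma zero_in_dual_space: "(\<lambda>x. 0) \<in> carrier (dual_space E)"
  by (auto simp: carrier_dual_space bounded_functional_def intro!: exI[of _ 0])

lemma smult_in_dual_space:
  assumes "f \<in> carrier (dual_space E)"
  shows "(\<lambda>x. c * f x) \<in> carrier (dual_space E)"
proof -
  obtain C where C: "\<And>x. x \<in> carrier E \<Longrightarrow> norm (f x) \<le> C * nrm E x"
    using dual_space_boundE[OF assms] by blast
  have "norm (c * f x) \<le> (norm c * C) * nrm E x" if "x \<in> carrier E" for x
    using mult_left_mono[OF C[OF that], of "norm c"] by (simp add: norm_mult mult.assoc)
  then have "\<exists>C. \<forall>x\<in>carrier E. norm (c * f x) \<le> C * nrm E x"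
    by blast
  then show ?thesis
    using assms by (simp add: carrier_dual_space bounded_functional_def distrib_left mult.left_commute)
qed

lemma add_in_dual_space:
  assumes "f \<in> carrier (dual_space E)" "g \<in> carrier (dual_space E)"
  shows "(\<lambda>x. f x + g x) \<in> carrier (dual_space E)"
proof -
  obtain C D where CD: "\<And>x. x \<in> carrier E \<Longrightarrow> norm (f x) \<le> C * nrm E x"
      "\<And>x. x \<in> carrier E \<Longrightarrow> norm (g x) \<le> D * nrm E x"
    using dual_space_boundE[OF assms(1)] dual_space_boundE[OF assms(2)] by metis
  have "norm (f x + g x) \<le> (C + D) * nrm E x" if "x \<in> carrier E" for x
    using norm_triangle_ineq[of "f x" "g x"] CD[OF that] by (simp add: algebra_simps)
  then have "\<exists>C. \<forall>x\<in>carrier E. norm (f x + g x) \<le> C * nrm E x"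
    by blast
  then show ?thesis
    using assms by (simp add: carrier_dual_space bounded_functional_def distrib_left)
qed

lemma linear_combination_in_dual_space:
  assumes "finite F" "\<And>n. n \<in> F \<Longrightarrow> y n \<in> carrier (dual_space E)"
  shows "(\<lambda>x. \<Sum>n\<in>F. c n * y n x) \<in> carrier (dual_space E)"
  using assms
  by (induction F rule: finite_induct)
     (auto intro!: zero_in_dual_space add_in_dual_space smult_in_dual_space)

lemma bidual_linear_combination:
  assumes \<phi>: "\<phi> \<in> carrier (dual_space (dual_space E))"
    and "finite F" "\<And>n. n \<in> F \<Longrightarrow> y n \<in> carrier (dual_space E)"
  shows "\<phi> (\<lambda>x. \<Sum>n\<in>F. c n * y n x) = (\<Sum>n\<in>F. c n * \<phi> (y n))"
proof -
  have add: "\<phi> (\<lambda>x. f x + g x) = \<phi> f + \<phi> g"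
    if "f \<in> carrier (dual_space E)" "g \<in> carrier (dual_space E)" for f g
    using \<phi> that unfolding carrier_dual_space[of \<phi>] bounded_functional_def by simp
  have smult: "\<phi> (\<lambda>x. b * f x) = b * \<phi> f" if "f \<in> carrier (dual_space E)" for b f
    using \<phi> that unfolding carrier_dual_space[of \<phi>] bounded_functional_def by simp
  show ?thesis
    using assms(2,3)
  proof (induction F rule: finite_induct)
    case empty
    then show ?case
      using smult[OF zero_in_dual_space, of 0] by simp
  next
    case (insert n F)
    then show ?case
      by (simp add: add smult smult_in_dual_space linear_combination_in_dual_space)
  qed
qed

context normed_space
begin

lemma norm_le_nrm_dual_space_on_ball:
  assumes "f \<in> carrier (dual_space E)" "x \<in> carrier E" "nrm E x \<le> 1"
  shows "norm (f x) \<le> nrm (dual_space E) f"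
proof -
  obtain C where C: "\<And>x. x \<in> carrier E \<Longrightarrow> norm (f x) \<le> C * nrm E x"
    using dual_space_boundE[OF assms(1)] by blast
  have "norm (f z) \<le> \<bar>C\<bar>" if "z \<in> carrier E" "nrm E z \<le> 1" for z
  proof -
    have "C * nrm E z \<le> \<bar>C\<bar> * 1"
      using that nrm_nonneg by (intro mult_mono) auto
    then show ?thesis
      using C[OF that(1)] by simp
  qed
  then have "bdd_above ((\<lambda>x. norm (f x)) ` {x \<in> carrier E. nrm E x \<le> 1})"
    by (intro bdd_aboveI2) auto
  then show ?thesis
    unfolding nrm_dual_space using assms by (intro cSUP_upper) auto
qed

lemma nrm_dual_space_nonneg: "f \<in> carrier (dual_space E) \<Longrightarrow> 0 \<le> nrm (dual_space E) f"
  using norm_le_nrm_dual_space_on_ball[of f \<zero>] norm_ge_zero[of "f \<zero>"]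
  by (simp add: nrm_zero del: norm_ge_zero)

lemma nrm_dual_space_le:
  assumes "\<And>x. x \<in> carrier E \<Longrightarrow> nrm E x \<le> 1 \<Longrightarrow> norm (f x) \<le> C"
  shows "nrm (dual_space E) f \<le> C"
  unfolding nrm_dual_space
proof (rule cSUP_least)
  have "\<zero> \<in> {x \<in> carrier E. nrm E x \<le> 1}"
    by (simp add: nrm_zero)
  then show "{x \<in> carrier E. nrm E x \<le> 1} \<noteq> {}"
    by blast
qed (use assms in auto)

lemma norm_le_nrm_dual_space:
  assumes f: "f \<in> carrier (dual_space E)" and x: "x \<in> carrier E"
  shows "norm (f x) \<le> nrm (dual_space E) f * nrm E x"
proof (cases "nrm E x = 0")
  case True
  obtain C where "norm (f x) \<le> C * nrm E x"
    using dual_space_boundE[OF f] x by metis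
  then show ?thesis
    using True by simp
next
  case False
  then have pos: "nrm E x > 0"
    using nrm_nonneg[OF x] by simp
  define c :: 'k where "c = of_real (inverse (nrm E x))"
  have "norm (f (c \<odot> x)) \<le> nrm (dual_space E) f"
    using x pos by (intro norm_le_nrm_dual_space_on_ball f) (auto simp: nrm_smult c_def norm_inverse)
  moreover have "norm (f (c \<odot> x)) = norm (f x) / nrm E x"
    using f x pos
    by (simp add: carrier_dual_space bounded_functional_def c_def norm_mult norm_inverse divide_inverse
        mult.commute)
  ultimately show ?thesis
    using pos by (simp add: pos_divide_le_eq)
qed

text \<open>
  The canonical embedding into the bidual; functions in a dual space are 0 off their domain.
\<close>

lemma evaluation_in_bidual:
  assumes "x \<in> carrier E"
  shows "(\<lambda>f. if f \<in> carrier (dual_space E) then f x else 0) \<in> carrier (dual_space (dual_space E))"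
  unfolding carrier_dual_space[of _ "dual_space E"] bounded_functional_def[of "dual_space E"]
  using norm_le_nrm_dual_space[OF _ assms]
  by (auto simp: add_in_dual_space smult_in_dual_space mult.commute intro!: exI[of _ "nrm E x"])

lemma weakly_null_dual_space_iff:
  assumes "\<And>n. y n \<in> carrier (dual_space E)"
  shows "weakly_null (dual_space E) y \<longleftrightarrow>
    (\<forall>\<phi> \<in> carrier (dual_space (dual_space E)). (\<lambda>n. \<phi> (y n)) \<longlonglongrightarrow> 0)"
proof -
  have "carrier (dual_space (dual_space E)) \<noteq> {}"
    using zero_in_dual_space by blast
  then have "weakly_null (dual_space E) y \<longleftrightarrow>
      (\<forall>\<phi> \<in> carrier (dual_space (dual_space E)). (\<lambda>n. \<phi> (y n)) \<longlonglongrightarrow> \<phi> (\<lambda>x. 0))"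
    using assms zero_in_dual_space[of E]
    by (simp add: weakly_null_def weak_topology_def limitin_initial_topology_iff)
  also have "\<dots> \<longleftrightarrow> (\<forall>\<phi> \<in> carrier (dual_space (dual_space E)). (\<lambda>n. \<phi> (y n)) \<longlonglongrightarrow> 0)"
  proof (intro ball_cong refl)
    fix \<phi> assume "\<phi> \<in> carrier (dual_space (dual_space E))"
    from bidual_linear_combination[OF this, of "{}"] have "\<phi> (\<lambda>x. 0) = 0"
      by simp
    then show "(\<lambda>n. \<phi> (y n)) \<longlonglongrightarrow> \<phi> (\<lambda>x. 0) \<longleftrightarrow> (\<lambda>n. \<phi> (y n)) \<longlonglongrightarrow> 0"
      by simp
  qed
  finally show ?thesis .
qed

lemma normal_seq_iff:
  "normal_seq E y \<longleftrightarrow>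
    (\<forall>n. y n \<in> unit_sphere (dual_space E)) \<and> (\<forall>x\<in>carrier E. (\<lambda>n. y n x) \<longlonglongrightarrow> 0)"
proof -
  have "(\<lambda>x f. f x) ` carrier E \<noteq> {}"
    using M.zero_closed by blast
  then have "limitin (weak_star_topology E) y \<zero>\<^bsub>dual_space E\<^esub> sequentially \<longleftrightarrow>
      eventually (\<lambda>n. y n \<in> carrier (dual_space E)) sequentially \<and>
      (\<forall>x\<in>carrier E. (\<lambda>n. y n x) \<longlonglongrightarrow> 0)"
    unfolding weak_star_topology_def
    by (simp add: limitin_initial_topology_iff zero_in_dual_space)
  then show ?thesis
    by (auto simp: normal_seq_def unit_sphere_def)
qed

lemma normal_seq_if_weakly_null:
  assumes y: "\<And>n. y n \<in> unit_sphere (dual_space E)" and null: "weakly_null (dual_space E) y"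
  shows "normal_seq E y"
proof -
  have y': "y n \<in> carrier (dual_space E)" for n
    using y by (simp add: unit_sphere_def)
  have "(\<lambda>n. y n x) \<longlonglongrightarrow> 0" if "x \<in> carrier E" for x
    using bspec[OF iffD1[OF weakly_null_dual_space_iff[OF y'] null] evaluation_in_bidual[OF that]] y'
    by simp
  then show ?thesis
    using y by (simp add: normal_seq_iff)
qed

text \<open>
  For a functional \<open>\<phi>\<close> on the dual, rotating each \<open>y n\<close> by a scalar of modulus 1 makes all \<open>\<phi> (y n)\<close> nonnegative, and the hypothesis bounds the norms of the rotated
  finite sums.  Hence the sums of \<open>\<bar>\<phi> (y n)\<bar>\<close> over \<open>m\<close> indices are at most a constant times
  the \<open>m\<close>-th harmonic number, which forces convergence to 0.
\<close>

lemma weakly_null_if_sums_le_harm: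
  assumes y: "\<And>n. y n \<in> carrier (dual_space E)"
    and le: "\<And>F x. finite F \<Longrightarrow> x \<in> carrier E \<Longrightarrow> (\<Sum>n\<in>F. norm (y n x)) \<le> harm (card F) * nrm E x"
  shows "weakly_null (dual_space E) y"
  unfolding weakly_null_dual_space_iff[of y, OF y]
proof
  fix \<phi> assume \<phi>: "\<phi> \<in> carrier (dual_space (dual_space E))"
  then obtain C where C: "\<And>f. f \<in> carrier (dual_space E) \<Longrightarrow> norm (\<phi> f) \<le> C * nrm (dual_space E) f"
    using dual_space_boundE by metis
  define s :: "nat \<Rightarrow> 'k"
    where "s n = (if \<phi> (y n) = 0 then 1 else of_real (norm (\<phi> (y n))) / \<phi> (y n))" for n
  have s: "s n * \<phi> (y n) = of_real (norm (\<phi> (y n)))" "norm (s n) = 1" for n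
    by (auto simp: s_def norm_divide)
  show "(\<lambda>n. \<phi> (y n)) \<longlonglongrightarrow> 0"
  proof (rule tendsto_0_if_sums_le_harm)
    fix F :: "nat set" assume F: "finite F"
    define g where "g = (\<lambda>x. \<Sum>n\<in>F. s n * y n x)"
    have g: "g \<in> carrier (dual_space E)"
      unfolding g_def by (intro linear_combination_in_dual_space F y)
    have "nrm (dual_space E) g \<le> harm (card F)"
    proof (rule nrm_dual_space_le)
      fix x assume x: "x \<in> carrier E" "nrm E x \<le> 1"
      have "norm (g x) \<le> (\<Sum>n\<in>F. norm (y n x))"
        unfolding g_def using norm_sum[of "\<lambda>n. s n * y n x" F] by (simp add: norm_mult s)
      also have "\<dots> \<le> harm (card F) * nrm E x"
        by (rule le[OF F x(1)])
      also have "\<dots> \<le> harm (card F)"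
        using x by (intro mult_left_le harm_nonneg)
      finally show "norm (g x) \<le> harm (card F)" .
    qed
    have "(\<Sum>n\<in>F. norm (\<phi> (y n))) = norm (\<Sum>n\<in>F. s n * \<phi> (y n))"
      unfolding s of_real_sum[symmetric] norm_of_real by (simp add: sum_nonneg)
    also have "\<dots> = norm (\<phi> g)"
      unfolding g_def by (subst bidual_linear_combination[OF \<phi> F y]) auto
    also have "\<dots> \<le> C * nrm (dual_space E) g"
      by (rule C[OF g])
    also have "\<dots> \<le> \<bar>C\<bar> * harm (card F)"
      using nrm_dual_space_nonneg[OF g] \<open>nrm (dual_space E) g \<le> harm (card F)\<close>
      by (intro mult_mono) auto
    finally show "(\<Sum>n\<in>F. norm (\<phi> (y n))) \<le> \<bar>C\<bar> * harm (card F)" .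
  qed
qed

text \<open>
  If a finite set \<open>B\<close> spanned the space, a subsequence tending to 0 geometrically fast on \<open>B\<close>
  would be absolutely summable on \<open>B\<close>, hence on the span of \<open>B\<close>, which is everything; so it
  would be strongly normal.  This makes the failure of strong normality itself the proof of
  infinite dimension.
\<close>

lemma infinite_dimensional_if_no_strongly_normal_subseq:
  assumes normal: "normal_seq E y" and none: "\<not> has_strongly_normal_subseq E y"
  shows "infinite_dimensional E"
  unfolding infinite_dimensional_def
proof
  assume "\<exists>B. finite B \<and> B \<subseteq> carrier E \<and>
    carrier E = \<Inter> {H. submodule H (ring_of_type_algebra :: 'k ring) E \<and> B \<subseteq> H}"
  then obtain B where B: "finite B" "B \<subseteq> carrier E"
    and span: "carrier E = \<Inter> {H. submodule H (ring_of_type_algebra :: 'k ring) E \<and> B \<subseteq> H}"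
    by blast
  have y: "y n \<in> carrier (dual_space E)" "y n \<in> unit_sphere (dual_space E)" for n
    using normal by (auto simp: normal_seq_def unit_sphere_def)
  have "(\<lambda>n. \<Sum>b\<in>B. norm (y n b)) \<longlonglongrightarrow> (\<Sum>b\<in>B. 0)"
    using normal B by (intro tendsto_sum tendsto_norm_zero) (auto simp: normal_seq_iff)
  then have small: "\<exists>n>m. (\<Sum>b\<in>B. norm (y n b)) < (1/2)^k" for k m :: nat
  proof -
    have "eventually (\<lambda>n. (\<Sum>b\<in>B. norm (y n b)) < (1/2)^k) sequentially"
      using \<open>_ \<longlonglongrightarrow> _\<close> by (intro order_tendstoD(2)) auto
    then have "eventually (\<lambda>n. n > m \<and> (\<Sum>b\<in>B. norm (y n b)) < (1/2)^k) sequentially"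
      by (intro eventually_conj eventually_gt_at_top)
    then show ?thesis
      by (auto dest: eventually_happens)
  qed
  obtain r where r: "\<And>k. (\<Sum>b\<in>B. norm (y (r k) b)) < (1/2)^k" "\<And>k. r k < r (Suc k)"
    using dependent_nat_choice[of "\<lambda>k n. (\<Sum>b\<in>B. norm (y n b)) < (1/2)^k" "\<lambda>k m n. m < n"] small
    by metis
  define H where "H = {x \<in> carrier E. summable (\<lambda>k. norm ((y \<circ> r) k x))}"
  have "submodule H (ring_of_type_algebra :: 'k ring) E"
  proof (rule submoduleI)
    have add: "y n (a \<oplus> b) = y n a + y n b" if "a \<in> carrier E" "b \<in> carrier E" for n a b
      using y(1)[of n] that by (simp add: carrier_dual_space bounded_functional_def)
    have smult: "y n (c \<odot> a) = c * y n a" if "a \<in> carrier E" for n c a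
      using y(1)[of n] that by (simp add: carrier_dual_space bounded_functional_def)
    show "\<zero> \<in> H"
      using smult[of \<zero> _ 0] by (simp add: H_def)
    show smultH: "c \<odot> a \<in> H" if "a \<in> H" for c a
      using that by (auto simp: H_def smult norm_mult intro: summable_mult)
    show "\<ominus> a \<in> H" if "a \<in> H" for a
      using smultH[OF that, of "- 1"] that by (simp add: H_def a_inv_eq_smult)
    show "a \<oplus> b \<in> H" if "a \<in> H" "b \<in> H" for a b
    proof -
      have "summable (\<lambda>k. norm (y (r k) a + y (r k) b))"
      proof (rule summable_comparison_test')
        show "summable (\<lambda>k. norm (y (r k) a) + norm (y (r k) b))"
          using that by (intro summable_add) (auto simp: H_def)
        show "norm (norm (y (r k) a + y (r k) b)) \<le> norm (y (r k) a) + norm (y (r k) b)" if "k \<ge> 0" for k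
          by (simp add: norm_triangle_ineq)
      qed
      then show ?thesis
        using that by (simp add: H_def add)
    qed
  qed (auto simp: H_def)
  moreover have "B \<subseteq> H"
  proof
    fix b assume b: "b \<in> B"
    have "norm (y (r k) b) \<le> (1/2)^k" for k
      using member_le_sum[of b B "\<lambda>b. norm (y (r k) b)"] B b r(1)[of k] by simp
    then have "summable (\<lambda>k. norm (y (r k) b))"
      using summable_comparison_test'[of "\<lambda>k. (1/2)^k :: real" 0 "\<lambda>k. norm (y (r k) b)"]
      by (simp add: summable_geometric)
    then show "b \<in> H"
      using B b by (auto simp: H_def)
  qed
  ultimately have "carrier E \<subseteq> H"
    unfolding span by blast
  then have "H = carrier E"
    unfolding H_def by blast
  interpret Metric_space "carrier E" "ndist E"
    by (rule Metric_space_ndist)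
  have "strongly_normal_seq E (y \<circ> r)"
    using y(2) \<open>H = carrier E\<close> closure_of_topspace[of mtopology]
    by (simp add: strongly_normal_seq_def norm_topology_def H_def)
  moreover have "strict_mono r"
    using r(2) by (simp add: strict_mono_Suc_iff)
  ultimately show False
    using none by (auto simp: has_strongly_normal_subseq_def)
qed

end

section \<open>The Banach space of absolutely summable families\<close>

lemma l1_space_simps [simp]:
  "\<zero>\<^bsub>l1_space \<Gamma>\<^esub> = (\<lambda>i. 0)"
  "x \<oplus>\<^bsub>l1_space \<Gamma>\<^esub> y = (\<lambda>i. x i + y i)"
  "c \<odot>\<^bsub>l1_space \<Gamma>\<^esub> x = (\<lambda>i. c * x i)"
  "nrm (l1_space \<Gamma>) x = (\<Sum>\<^sub>\<infinity>\<gamma>\<in>\<Gamma>. norm (x \<gamma>))"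
  by (simp_all add: l1_space_def)

lemma carrier_l1_space:
  "x \<in> carrier (l1_space \<Gamma>) \<longleftrightarrow> (\<lambda>\<gamma>. norm (x \<gamma>)) summable_on \<Gamma> \<and> (\<forall>\<gamma>. \<gamma> \<notin> \<Gamma> \<longrightarrow> x \<gamma> = 0)"
  by (simp add: l1_space_def)

lemma add_in_l1_space:
  assumes "x \<in> carrier (l1_space \<Gamma>)" "y \<in> carrier (l1_space \<Gamma>)"
  shows "(\<lambda>i. x i + y i) \<in> carrier (l1_space \<Gamma>)"
proof -
  have "(\<lambda>i. norm (x i) + norm (y i)) summable_on \<Gamma>"
    using assms by (intro summable_on_add) (auto simp: carrier_l1_space)
  then have "(\<lambda>i. norm (x i + y i)) summable_on \<Gamma>"
    by (rule summable_on_comparison_test) (auto simp: norm_triangle_ineq)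
  then show ?thesis
    using assms by (simp add: carrier_l1_space)
qed

lemma smult_in_l1_space:
  assumes "x \<in> carrier (l1_space \<Gamma>)"
  shows "(\<lambda>i. c * x i) \<in> carrier (l1_space \<Gamma>)"
  using assms by (simp add: carrier_l1_space norm_mult summable_on_cmult_right)

lemma normed_space_l1_space:
  "normed_space (l1_space \<Gamma> :: ('k::real_normed_field, 'g \<Rightarrow> 'k) normed_module)"
proof -
  let ?E = "l1_space \<Gamma> :: ('k, 'g \<Rightarrow> 'k) normed_module"
  have group: "abelian_group ?E"
  proof (rule abelian_groupI)
    show "\<exists>y \<in> carrier ?E. y \<oplus>\<^bsub>?E\<^esub> x = \<zero>\<^bsub>?E\<^esub>" if "x \<in> carrier ?E" for x
      using smult_in_l1_space[OF that, of "- 1"] by (intro bexI[of _ "\<lambda>i. - 1 * x i"]) auto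
  qed (auto simp: add_in_l1_space carrier_l1_space[of "\<lambda>i. 0"] add.assoc add.commute)
  have "module (ring_of_type_algebra :: 'k ring) ?E"
    by (rule moduleI[OF cring_from_type_algebra group])
       (auto simp: smult_in_l1_space algebra_simps)
  moreover have "normed_space_axioms ?E"
  proof
    show "nrm ?E x = 0 \<longleftrightarrow> x = \<zero>\<^bsub>?E\<^esub>" if x: "x \<in> carrier ?E" for x
    proof
      assume zero: "nrm ?E x = 0"
      have "x i = 0" for i
      proof (cases "i \<in> \<Gamma>")
        case True
        have "norm (x i) = 0"
          by (rule nonneg_infsum_le_0D[OF _ _ _ True]) (use zero x in \<open>simp_all add: carrier_l1_space\<close>)
        then show ?thesis by simp
      next
        case False
        then show ?thesis
          using x by (simp add: carrier_l1_space)
      qed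
      then show "x = \<zero>\<^bsub>?E\<^esub>"
        by (simp add: fun_eq_iff)
    qed simp
    show "nrm ?E (c \<odot>\<^bsub>?E\<^esub> x) = norm c * nrm ?E x" for c x
      by (simp add: norm_mult infsum_cmult_right')
    show "nrm ?E (x \<oplus>\<^bsub>?E\<^esub> y) \<le> nrm ?E x + nrm ?E y" if "x \<in> carrier ?E" "y \<in> carrier ?E" for x y
    proof -
      have summable: "(\<lambda>i. norm (x i)) summable_on \<Gamma>" "(\<lambda>i. norm (y i)) summable_on \<Gamma>"
          "(\<lambda>i. norm (x i + y i)) summable_on \<Gamma>"
        using that add_in_l1_space[OF that] by (simp_all add: carrier_l1_space)
      then have "(\<Sum>\<^sub>\<infinity>i\<in>\<Gamma>. norm (x i + y i)) \<le> (\<Sum>\<^sub>\<infinity>i\<in>\<Gamma>. norm (x i) + norm (y i))"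
        by (intro infsum_mono norm_triangle_ineq summable_on_add[OF summable(1,2)])
      then have "nrm ?E (x \<oplus>\<^bsub>?E\<^esub> y) \<le> (\<Sum>\<^sub>\<infinity>i\<in>\<Gamma>. norm (x i) + norm (y i))"
        by simp
      also have "\<dots> = nrm ?E x + nrm ?E y"
        using summable by (simp add: infsum_add)
      finally show ?thesis .
    qed
  qed
  ultimately show ?thesis
    by (simp add: normed_space_def)
qed

lemma l1_space_minus:
  assumes "x \<in> carrier (l1_space \<Gamma>)" "y \<in> carrier (l1_space \<Gamma>)"
  shows "x \<ominus>\<^bsub>l1_space \<Gamma>\<^esub> y = (\<lambda>i. x i - y i)"
proof -
  interpret normed_space "l1_space \<Gamma>"
    by (rule normed_space_l1_space)
  show ?thesis
    using assms by (simp add: a_minus_def a_inv_eq_smult)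
qed

lemma minus_in_l1_space:
  assumes "x \<in> carrier (l1_space \<Gamma>)" "y \<in> carrier (l1_space \<Gamma>)"
  shows "(\<lambda>i. x i - y i) \<in> carrier (l1_space \<Gamma>)"
  using add_in_l1_space[OF assms(1) smult_in_l1_space[OF assms(2), of "- 1"]] by simp

lemma sum_norm_le_nrm_l1_space:
  assumes "x \<in> carrier (l1_space \<Gamma>)" "finite F" "F \<subseteq> \<Gamma>"
  shows "(\<Sum>i\<in>F. norm (x i)) \<le> nrm (l1_space \<Gamma>) x"
  using assms by (auto simp: carrier_l1_space intro!: finite_sum_le_infsum)

lemma norm_le_nrm_l1_space:
  assumes "x \<in> carrier (l1_space \<Gamma>)"
  shows "norm (x i) \<le> nrm (l1_space \<Gamma>) x"
proof (cases "i \<in> \<Gamma>")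
  case True
  then show ?thesis
    using sum_norm_le_nrm_l1_space[OF assms, of "{i}"] by simp
next
  case False
  then show ?thesis
    using assms by (simp add: carrier_l1_space infsum_nonneg)
qed

lemma l1_space_memI:
  assumes "\<And>F. finite F \<Longrightarrow> F \<subseteq> \<Gamma> \<Longrightarrow> (\<Sum>i\<in>F. norm (x i)) \<le> C" "\<And>i. i \<notin> \<Gamma> \<Longrightarrow> x i = 0"
  shows "x \<in> carrier (l1_space \<Gamma>)" "nrm (l1_space \<Gamma>) x \<le> C"
proof -
  have summable: "(\<lambda>i. norm (x i)) summable_on \<Gamma>"
    using assms(1) by (intro nonneg_bdd_above_summable_on bdd_aboveI2) auto
  then show "x \<in> carrier (l1_space \<Gamma>)"
    using assms(2) by (simp add: carrier_l1_space)
  show "nrm (l1_space \<Gamma>) x \<le> C"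
    using infsum_le_finite_sums[OF summable] assms(1) by simp
qed

text \<open>
  A Cauchy sequence converges coordinatewise, and the Cauchy estimate passes to the limit in
  every finite partial sum of the norm.
\<close>

lemma banach_space_l1_space:
  "banach_space (l1_space \<Gamma> :: ('k::{real_normed_field,banach}, 'g \<Rightarrow> 'k) normed_module)"
proof -
  let ?E = "l1_space \<Gamma> :: ('k, 'g \<Rightarrow> 'k) normed_module"
  interpret E: normed_space ?E
    by (rule normed_space_l1_space)
  interpret Metric_space "carrier ?E" "ndist ?E"
    by (rule E.Metric_space_ndist)
  have "\<exists>x. limitin mtopology \<sigma> x sequentially" if "MCauchy \<sigma>" for \<sigma>
  proof -
    have \<sigma>: "\<sigma> n \<in> carrier ?E" for n
      using that by (auto simp: MCauchy_def)
    have cauchy: "\<exists>N. \<forall>m\<ge>N. \<forall>n\<ge>N. nrm ?E (\<lambda>i. \<sigma> m i - \<sigma> n i) < \<epsilon>" if "\<epsilon> > 0" for \<epsilon>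
    proof -
      obtain N where "\<And>m n. N \<le> m \<Longrightarrow> N \<le> n \<Longrightarrow> ndist ?E (\<sigma> m) (\<sigma> n) < \<epsilon>"
        using \<open>MCauchy \<sigma>\<close> \<open>\<epsilon> > 0\<close> unfolding MCauchy_def by metis
      then show ?thesis
        using \<sigma> by (auto simp: ndist_def l1_space_minus simp del: l1_space_simps)
    qed
    have "Cauchy (\<lambda>n. \<sigma> n i)" for i
    proof (rule CauchyI)
      fix \<epsilon> :: real assume "\<epsilon> > 0"
      then show "\<exists>N. \<forall>m\<ge>N. \<forall>n\<ge>N. norm (\<sigma> m i - \<sigma> n i) < \<epsilon>"
        using cauchy norm_le_nrm_l1_space[OF minus_in_l1_space[OF \<sigma> \<sigma>]] by (meson le_less_trans)
    qed
    then obtain x where x: "\<And>i. (\<lambda>n. \<sigma> n i) \<longlonglongrightarrow> x i"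
      unfolding Cauchy_convergent_iff convergent_def by metis
    have x_0: "x i = 0" if "i \<notin> \<Gamma>" for i
      using LIMSEQ_unique[OF x[of i], of 0] \<sigma> that by (simp add: carrier_l1_space)
    have close: "(\<lambda>i. \<sigma> n i - x i) \<in> carrier ?E \<and> nrm ?E (\<lambda>i. \<sigma> n i - x i) \<le> \<epsilon>"
      if N: "\<forall>m\<ge>N. \<forall>n\<ge>N. nrm ?E (\<lambda>i. \<sigma> m i - \<sigma> n i) < \<epsilon>" and "n \<ge> N" for \<epsilon> N n
    proof -
      have "(\<Sum>i\<in>F. norm (\<sigma> n i - x i)) \<le> \<epsilon>" if F: "finite F" "F \<subseteq> \<Gamma>" for F
      proof (rule tendsto_upperbound)
        show "(\<lambda>m. \<Sum>i\<in>F. norm (\<sigma> n i - \<sigma> m i)) \<longlonglongrightarrow> (\<Sum>i\<in>F. norm (\<sigma> n i - x i))"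
          by (intro tendsto_intros x)
        have "(\<Sum>i\<in>F. norm (\<sigma> n i - \<sigma> m i)) \<le> \<epsilon>" if "m \<ge> N" for m
          using sum_norm_le_nrm_l1_space[OF minus_in_l1_space[OF \<sigma> \<sigma>] F, of n m] N that \<open>n \<ge> N\<close>
          by (meson less_imp_le order_trans)
        then show "eventually (\<lambda>m. (\<Sum>i\<in>F. norm (\<sigma> n i - \<sigma> m i)) \<le> \<epsilon>) sequentially"
          by (auto simp: eventually_sequentially)
      qed simp
      then show ?thesis
        using l1_space_memI[of \<Gamma> "\<lambda>i. \<sigma> n i - x i" \<epsilon>] \<sigma> x_0 by (simp add: carrier_l1_space)
    qed
    \<comment> \<open>One term at finite distance from \<open>x\<close> suffices to put \<open>x\<close> into the space.\<close>
    obtain N where "\<forall>m\<ge>N. \<forall>n\<ge>N. nrm ?E (\<lambda>i. \<sigma> m i - \<sigma> n i) < 1"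
      using cauchy[of 1] by auto
    from close[OF this order_refl] have x_mem: "x \<in> carrier ?E"
      using minus_in_l1_space[OF \<sigma>[of N], of "\<lambda>i. \<sigma> N i - x i"] by simp
    have "\<exists>N. \<forall>n\<ge>N. \<sigma> n \<in> carrier ?E \<and> ndist ?E (\<sigma> n) x < \<epsilon>" if "\<epsilon> > 0" for \<epsilon>
    proof -
      obtain N where "\<forall>m\<ge>N. \<forall>n\<ge>N. nrm ?E (\<lambda>i. \<sigma> m i - \<sigma> n i) < \<epsilon> / 2"
        using cauchy[of "\<epsilon> / 2"] \<open>\<epsilon> > 0\<close> by auto
      from close[OF this] \<open>\<epsilon> > 0\<close> have "nrm ?E (\<lambda>i. \<sigma> n i - x i) < \<epsilon>" if "n \<ge> N" for n
        using that by fastforce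
      then show ?thesis
        using \<sigma> x_mem by (auto simp: ndist_def l1_space_minus simp del: l1_space_simps)
    qed
    then show ?thesis
      using x_mem unfolding limit_metric_sequentially by blast
  qed
  then show ?thesis
    by (auto simp: banach_space_def mcomplete_def normed_space_l1_space)
qed

definition l1_unit :: "'g \<Rightarrow> 'g \<Rightarrow> 'k::real_normed_field" where
  "l1_unit \<gamma> = (\<lambda>i. if i = \<gamma> then 1 else 0)"

lemma l1_unit_in_l1_space:
  assumes "\<gamma> \<in> \<Gamma>"
  shows "(l1_unit \<gamma> :: 'g \<Rightarrow> 'k::real_normed_field) \<in> carrier (l1_space \<Gamma>)"
    and "nrm (l1_space \<Gamma>) (l1_unit \<gamma> :: 'g \<Rightarrow> 'k) = 1"
proof -
  have "((\<lambda>i. norm (l1_unit \<gamma> i :: 'k)) has_sum 1) \<Gamma>"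
    using assms by (intro has_sum_finite_neutralI[of "{\<gamma>}"]) (auto simp: l1_unit_def)
  then show "(l1_unit \<gamma> :: 'g \<Rightarrow> 'k) \<in> carrier (l1_space \<Gamma>)"
      "nrm (l1_space \<Gamma>) (l1_unit \<gamma> :: 'g \<Rightarrow> 'k) = 1"
    using assms has_sum_imp_summable by (auto simp: carrier_l1_space l1_unit_def infsumI)
qed

section \<open>The counterexample sequence of functionals\<close>

text \<open>
  The element \<open>\<gamma>\<close> of the index set stands for the set \<open>A \<gamma>\<close> of naturals.  Under
  the duality with bounded families on \<open>\<Gamma>\<close>, these functionals are the columns of the matrix
  whose row at \<open>\<gamma>\<close> lists the reciprocal ranks of \<open>A \<gamma>\<close>.
\<close>

definition rank_functional ::
  "'g set \<Rightarrow> ('g \<Rightarrow> nat set) \<Rightarrow> nat \<Rightarrow> ('g \<Rightarrow> 'k::{real_normed_field,banach}) \<Rightarrow> 'k" where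
  "rank_functional \<Gamma> A n x =
     (if x \<in> carrier (l1_space \<Gamma>) then \<Sum>\<^sub>\<infinity>\<gamma>\<in>\<Gamma>. of_real (reciprocal_rank (A \<gamma>) n) * x \<gamma> else 0)"

lemma norm_reciprocal_rank_mult_le:
  "norm (of_real (reciprocal_rank A n) * z :: 'k::real_normed_field) \<le> norm z"
  using mult_right_mono[OF reciprocal_rank_le_1[of A n], of "norm z"]
  by (simp add: norm_mult reciprocal_rank_nonneg)

lemma reciprocal_rank_abs_summable:
  fixes x :: "'g \<Rightarrow> 'k::real_normed_field"
  assumes "x \<in> carrier (l1_space \<Gamma>)"
  shows "(\<lambda>\<gamma>. of_real (reciprocal_rank (A \<gamma>) n) * x \<gamma>) abs_summable_on \<Gamma>"
proof (rule summable_on_comparison_test)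
  show "(\<lambda>\<gamma>. norm (x \<gamma>)) summable_on \<Gamma>"
    using assms by (simp add: carrier_l1_space)
qed (simp_all add: norm_reciprocal_rank_mult_le)

lemma reciprocal_rank_summable:
  fixes x :: "'g \<Rightarrow> 'k::{real_normed_field,banach}"
  assumes "x \<in> carrier (l1_space \<Gamma>)"
  shows "(\<lambda>\<gamma>. of_real (reciprocal_rank (A \<gamma>) n) * x \<gamma>) summable_on \<Gamma>"
  by (rule abs_summable_summable[OF reciprocal_rank_abs_summable[OF assms]])

lemma rank_functional_add:
  assumes "x \<in> carrier (l1_space \<Gamma>)" "y \<in> carrier (l1_space \<Gamma>)"
  shows "rank_functional \<Gamma> A n (\<lambda>i. x i + y i) = rank_functional \<Gamma> A n x + rank_functional \<Gamma> A n y"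
  using assms
  by (simp add: rank_functional_def add_in_l1_space distrib_left infsum_add reciprocal_rank_summable)

lemma has_sum_finite_sum:
  fixes f :: "'i \<Rightarrow> 'j \<Rightarrow> 'b::topological_comm_monoid_add"
  assumes "finite F" "\<And>n. n \<in> F \<Longrightarrow> (f n has_sum s n) I"
  shows "((\<lambda>i. \<Sum>n\<in>F. f n i) has_sum (\<Sum>n\<in>F. s n)) I"
  using assms by (induction F rule: finite_induct) (auto intro!: has_sum_add)

text \<open>
  Summing over \<open>F\<close> first, the coordinate \<open>\<gamma>\<close> contributes at most the harmonic number of
  \<open>card F\<close> times \<open>\<bar>x \<gamma>\<bar>\<close>, whatever the set \<open>A \<gamma>\<close> is.
\<close>

lemma sum_norm_rank_functional_le:
  assumes x: "x \<in> carrier (l1_space \<Gamma>)" and F: "finite F"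
  shows "(\<Sum>n\<in>F. norm (rank_functional \<Gamma> A n x)) \<le> harm (card F) * nrm (l1_space \<Gamma>) x"
proof -
  let ?t = "\<lambda>n \<gamma>. norm (of_real (reciprocal_rank (A \<gamma>) n) * x \<gamma>)"
  have summable: "(\<lambda>\<gamma>. norm (x \<gamma>)) summable_on \<Gamma>"
    using x by (simp add: carrier_l1_space)
  have t: "((\<lambda>\<gamma>. \<Sum>n\<in>F. ?t n \<gamma>) has_sum (\<Sum>n\<in>F. \<Sum>\<^sub>\<infinity>\<gamma>\<in>\<Gamma>. ?t n \<gamma>)) \<Gamma>"
    by (intro has_sum_finite_sum[OF F] has_sum_infsum reciprocal_rank_abs_summable x)
  have "(\<Sum>n\<in>F. norm (rank_functional \<Gamma> A n x)) \<le> (\<Sum>n\<in>F. \<Sum>\<^sub>\<infinity>\<gamma>\<in>\<Gamma>. ?t n \<gamma>)"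
    unfolding rank_functional_def if_P[OF x]
    by (intro sum_mono norm_infsum_bound reciprocal_rank_abs_summable x)
  also have "\<dots> = (\<Sum>\<^sub>\<infinity>\<gamma>\<in>\<Gamma>. \<Sum>n\<in>F. ?t n \<gamma>)"
    using t by (simp add: infsumI)
  also have "\<dots> \<le> (\<Sum>\<^sub>\<infinity>\<gamma>\<in>\<Gamma>. harm (card F) * norm (x \<gamma>))"
  proof (rule infsum_mono)
    show "(\<lambda>\<gamma>. \<Sum>n\<in>F. ?t n \<gamma>) summable_on \<Gamma>"
      using t by (rule has_sum_imp_summable)
    show "(\<lambda>\<gamma>. harm (card F) * norm (x \<gamma>)) summable_on \<Gamma>"
      using summable by (rule summable_on_cmult_right)
    show "(\<Sum>n\<in>F. ?t n \<gamma>) \<le> harm (card F) * norm (x \<gamma>)" for \<gamma>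
      using mult_right_mono[OF sum_reciprocal_rank_le_harm[OF F, of "A \<gamma>"], of "norm (x \<gamma>)"]
      by (simp add: norm_mult reciprocal_rank_nonneg sum_distrib_right)
  qed
  also have "\<dots> = harm (card F) * nrm (l1_space \<Gamma>) x"
    by (simp add: infsum_cmult_right')
  finally show ?thesis .
qed

lemma rank_functional_l1_unit:
  assumes "\<gamma> \<in> \<Gamma>"
  shows "rank_functional \<Gamma> A n (l1_unit \<gamma>) = (of_real (reciprocal_rank (A \<gamma>) n) :: 'k::{real_normed_field,banach})"
proof -
  have "((\<lambda>i. of_real (reciprocal_rank (A i) n) * (l1_unit \<gamma> i :: 'k)) has_sum
      of_real (reciprocal_rank (A \<gamma>) n)) \<Gamma>"
    using assms by (intro has_sum_finite_neutralI[of "{\<gamma>}"]) (auto simp: l1_unit_def)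
  then show ?thesis
    using assms by (simp add: rank_functional_def l1_unit_in_l1_space infsumI)
qed

lemma rank_functional_in_dual_space:
  "(rank_functional \<Gamma> A n :: ('g \<Rightarrow> 'k::{real_normed_field,banach}) \<Rightarrow> 'k) \<in> carrier (dual_space (l1_space \<Gamma>))"
proof -
  have "norm (rank_functional \<Gamma> A n x) \<le> 1 * nrm (l1_space \<Gamma>) x" if "x \<in> carrier (l1_space \<Gamma>)"
    for x :: "'g \<Rightarrow> 'k"
    using sum_norm_rank_functional_le[OF that, of "{n}" A] by (simp add: harm_expand)
  then have "\<exists>C. \<forall>x\<in>carrier (l1_space \<Gamma>).
      norm (rank_functional \<Gamma> A n (x :: 'g \<Rightarrow> 'k)) \<le> C * nrm (l1_space \<Gamma>) x"
    by blast
  moreover have "rank_functional \<Gamma> A n (\<lambda>i. c * x i) = c * rank_functional \<Gamma> A n x"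
    if "x \<in> carrier (l1_space \<Gamma>)" for c and x :: "'g \<Rightarrow> 'k"
    using that by (simp add: rank_functional_def smult_in_l1_space infsum_cmult_right'[symmetric] mult.left_commute)
  moreover have "rank_functional \<Gamma> A n (x :: 'g \<Rightarrow> 'k) = 0" if "x \<notin> carrier (l1_space \<Gamma>)" for x
    using that by (simp add: rank_functional_def)
  ultimately show ?thesis
    by (simp add: carrier_dual_space bounded_functional_def rank_functional_add del: l1_space_simps(4))
qed

text \<open>
  The norm 1 is attained at a unit vector whose set has \<open>n\<close> as its least element; a singleton
  is the simplest choice.
\<close>

lemma rank_functional_in_unit_sphere:
  assumes "\<gamma> \<in> \<Gamma>" "A \<gamma> = {n}"
  shows "(rank_functional \<Gamma> A n :: ('g \<Rightarrow> 'k::{real_normed_field,banach}) \<Rightarrow> 'k) \<in> unit_sphere (dual_space (l1_space \<Gamma>))"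
proof -
  interpret normed_space "l1_space \<Gamma> :: ('k, 'g \<Rightarrow> 'k) normed_module"
    by (rule normed_space_l1_space)
  let ?f = "rank_functional \<Gamma> A n :: ('g \<Rightarrow> 'k) \<Rightarrow> 'k"
  have "norm (?f x) \<le> 1" if "x \<in> carrier (l1_space \<Gamma>)" "nrm (l1_space \<Gamma>) x \<le> 1" for x
    using sum_norm_rank_functional_le[OF that(1), of "{n}" A] that(2) by (simp add: harm_expand)
  then have "nrm (dual_space (l1_space \<Gamma>)) ?f \<le> 1"
    by (rule nrm_dual_space_le)
  moreover have "{m. m = n \<and> m \<le> n} = {n}"
    by auto
  then have "norm (?f (l1_unit \<gamma>)) = 1"
    using assms by (simp add: rank_functional_l1_unit reciprocal_rank_def)
  then have "1 \<le> nrm (dual_space (l1_space \<Gamma>)) ?f"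
    using norm_le_nrm_dual_space_on_ball[OF rank_functional_in_dual_space l1_unit_in_l1_space(1)[OF assms(1)]]
      l1_unit_in_l1_space(2)[OF assms(1)] by (metis order_refl)
  ultimately show ?thesis
    using rank_functional_in_dual_space by (auto simp: unit_sphere_def)
qed

lemma weakly_null_rank_functional:
  "weakly_null (dual_space (l1_space \<Gamma>)) (rank_functional \<Gamma> A :: nat \<Rightarrow> ('g \<Rightarrow> 'k::{real_normed_field,banach}) \<Rightarrow> 'k)"
proof -
  interpret normed_space "l1_space \<Gamma> :: ('k, 'g \<Rightarrow> 'k) normed_module"
    by (rule normed_space_l1_space)
  show "weakly_null (dual_space (l1_space \<Gamma>)) (rank_functional \<Gamma> A :: nat \<Rightarrow> ('g \<Rightarrow> 'k) \<Rightarrow> 'k)"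
    by (rule weakly_null_if_sums_le_harm[OF rank_functional_in_dual_space sum_norm_rank_functional_le])
qed

text \<open>
  Along \<open>A \<gamma> = range r\<close> the unit vector at \<open>\<gamma>\<close> produces exactly the harmonic numbers as partial
  sums.  A perturbation \<open>z\<close> of norm \<open>d < 1\<close> changes the \<open>m\<close>-th partial sum by at most \<open>d\<close> times
  the \<open>m\<close>-th harmonic number, so the partial sums remain unbounded.
\<close>

lemma not_summable_rank_functional:
  fixes x :: "'g \<Rightarrow> 'k::{real_normed_field,banach}"
  assumes r: "strict_mono r" and \<gamma>: "\<gamma> \<in> \<Gamma>" "A \<gamma> = range r"
    and x: "x \<in> carrier (l1_space \<Gamma>)" and dist: "ndist (l1_space \<Gamma>) (l1_unit \<gamma>) x < 1"
  shows "\<not> summable (\<lambda>k. norm (rank_functional \<Gamma> A (r k) x))"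
proof
  assume summable: "summable (\<lambda>k. norm (rank_functional \<Gamma> A (r k) x))"
  define z where "z = (\<lambda>i. l1_unit \<gamma> i - x i)"
  define d where "d = nrm (l1_space \<Gamma>) z"
  have z: "z \<in> carrier (l1_space \<Gamma>)"
    unfolding z_def by (intro minus_in_l1_space l1_unit_in_l1_space \<gamma> x)
  have "d < 1"
    using dist x \<gamma>(1) by (simp add: d_def z_def ndist_def l1_space_minus l1_unit_in_l1_space del: l1_space_simps)
  have split: "of_real (1 / real (Suc k)) = rank_functional \<Gamma> A (r k) z + rank_functional \<Gamma> A (r k) x" for k
  proof -
    have "rank_functional \<Gamma> A (r k) (l1_unit \<gamma>) = rank_functional \<Gamma> A (r k) (\<lambda>i. z i + x i)"
      by (simp add: z_def)
    then show ?thesis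
      using rank_functional_add[OF z x] \<gamma> r by (simp only: rank_functional_l1_unit reciprocal_rank_range)
  qed
  have "(1 - d) * harm m \<le> (\<Sum>k. norm (rank_functional \<Gamma> A (r k) x))" for m
  proof -
    have inj: "inj_on r {..<m}"
      using r by (simp add: strict_mono_imp_inj_on inj_on_subset)
    have "harm m = (\<Sum>k<m. norm (of_real (1 / real (Suc k)) :: 'k))"
      by (simp add: harm_altdef inverse_eq_divide norm_divide del: of_nat_Suc)
    also have "\<dots> \<le> (\<Sum>k<m. norm (rank_functional \<Gamma> A (r k) z)) + (\<Sum>k<m. norm (rank_functional \<Gamma> A (r k) x))"
      unfolding split sum.distrib[symmetric] by (intro sum_mono norm_triangle_ineq)
    also have "(\<Sum>k<m. norm (rank_functional \<Gamma> A (r k) z)) \<le> harm m * d"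
      using sum_norm_rank_functional_le[OF z, of "r ` {..<m}" A] inj
      by (simp add: sum.reindex card_image d_def del: l1_space_simps)
    also have "(\<Sum>k<m. norm (rank_functional \<Gamma> A (r k) x)) \<le> (\<Sum>k. norm (rank_functional \<Gamma> A (r k) x))"
      by (intro sum_le_suminf summable) auto
    finally show ?thesis
      by (simp add: algebra_simps)
  qed
  moreover have "filterlim (\<lambda>m. (1 - d) * harm m) at_top sequentially"
    using \<open>d < 1\<close> by (intro filterlim_tendsto_pos_mult_at_top[OF tendsto_const] harm_at_top) auto
  ultimately show False
    using filterlim_at_top_dense[of "\<lambda>m. (1 - d) * harm m" sequentially]
    by (meson eventually_happens' sequentially_bot not_less)
qed

text \<open>
  Every subsequence \<open>r\<close> is defeated by its own range: since \<open>A\<close> takes the value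
  \<^term>\<open>range r\<close> at some \<open>\<gamma>\<close>, the open unit ball around the unit vector at \<open>\<gamma>\<close> contains no point
  at which the subsequence is absolutely summable.
\<close>

lemma no_strongly_normal_subseq_rank_functional:
  assumes "A ` \<Gamma> = UNIV"
  shows "\<not> has_strongly_normal_subseq (l1_space \<Gamma>)
    (rank_functional \<Gamma> A :: nat \<Rightarrow> ('g \<Rightarrow> 'k::{real_normed_field,banach}) \<Rightarrow> 'k)"
proof
  let ?E = "l1_space \<Gamma> :: ('k, 'g \<Rightarrow> 'k) normed_module"
  interpret E: normed_space ?E
    by (rule normed_space_l1_space)
  interpret Metric_space "carrier ?E" "ndist ?E"
    by (rule E.Metric_space_ndist)
  assume "has_strongly_normal_subseq ?E (rank_functional \<Gamma> A)"
  then obtain r where r: "strict_mono r" and dense: "mtopology closure_of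
      {x \<in> carrier ?E. summable (\<lambda>k. norm (rank_functional \<Gamma> A (r k) x))} = carrier ?E"
    by (auto simp: has_strongly_normal_subseq_def strongly_normal_seq_def norm_topology_def)
  obtain \<gamma> where \<gamma>: "\<gamma> \<in> \<Gamma>" "A \<gamma> = range r"
    using assms by (metis UNIV_I imageE)
  have "l1_unit \<gamma> \<in> mtopology closure_of
      {x \<in> carrier ?E. summable (\<lambda>k. norm (rank_functional \<Gamma> A (r k) x))}"
    unfolding dense by (rule l1_unit_in_l1_space[OF \<gamma>(1)])
  then obtain x where "x \<in> carrier ?E" "summable (\<lambda>k. norm (rank_functional \<Gamma> A (r k) x))"
      "ndist ?E (l1_unit \<gamma>) x < 1"
    unfolding metric_closure_of by (auto dest!: spec[of _ 1])
  then show False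
    using not_summable_rank_functional[of r \<gamma> \<Gamma> A x] r \<gamma> by blast
qed

proposition weakly_null_without_strongly_normal_subseq:
  fixes \<Gamma> :: "'g set"
  assumes "(UNIV :: nat set set) \<lesssim> \<Gamma>"
  shows "\<exists>y. (\<forall>n. y n \<in> unit_sphere (dual_space (l1_space \<Gamma>))) \<and>
    weakly_null (dual_space (l1_space \<Gamma>)) y \<and>
    \<not> has_strongly_normal_subseq (l1_space \<Gamma> :: ('k::{real_normed_field,banach}, 'g \<Rightarrow> 'k) normed_module) y"
proof -
  obtain j :: "nat set \<Rightarrow> 'g" where j: "inj j" "range j \<subseteq> \<Gamma>"
    using assms by (auto simp: lepoll_def)
  define A where "A = inv_into UNIV j"
  have "A (j S) = S" for S
    using j(1) by (simp add: A_def)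
  then have A: "A ` \<Gamma> = UNIV"
    using j(2) by (metis UNIV_eq_I image_eqI range_subsetD)
  have "rank_functional \<Gamma> A n \<in> unit_sphere (dual_space (l1_space \<Gamma> :: ('k, 'g \<Rightarrow> 'k) normed_module))" for n
  proof -
    obtain \<gamma> where "\<gamma> \<in> \<Gamma>" "A \<gamma> = {n}"
      using A by (metis UNIV_I imageE)
    then show ?thesis
      by (rule rank_functional_in_unit_sphere)
  qed
  then show ?thesis
    using weakly_null_rank_functional no_strongly_normal_subseq_rank_functional[OF A] by blast
qed

corollary banach_space_without_strongly_normal_subseq:
  "\<exists>(E :: ('k::{real_normed_field,banach}, nat set \<Rightarrow> 'k) normed_module) y.
     banach_space E \<and> infinite_dimensional E \<and> normal_seq E y \<and>
     weakly_null (dual_space E) y \<and> \<not> has_strongly_normal_subseq E y"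
proof -
  let ?E = "l1_space UNIV :: ('k, nat set \<Rightarrow> 'k) normed_module"
  interpret normed_space ?E
    by (rule normed_space_l1_space)
  obtain y where "\<forall>n. y n \<in> unit_sphere (dual_space ?E)" and y: "weakly_null (dual_space ?E) y"
      "\<not> has_strongly_normal_subseq ?E y"
    using weakly_null_without_strongly_normal_subseq[OF lepoll_refl, where 'k = 'k] by blast
  then have "normal_seq ?E y"
    using normal_seq_if_weakly_null by blast
  then show ?thesis
    using banach_space_l1_space infinite_dimensional_if_no_strongly_normal_subseq y by blast
qed

theorem theorem1:
  shows
    "(\<forall>\<Gamma> :: 'g set. (UNIV :: nat set set) \<lesssim> \<Gamma> \<longrightarrow>
        (let E = (l1_space \<Gamma> :: (real, 'g \<Rightarrow> real) normed_module) in
           \<exists>y. (\<forall>n. y n \<in> unit_sphere (dual_space E)) \<and> weakly_null (dual_space E) y \<and>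
               \<not> has_strongly_normal_subseq E y) \<and>
        (let E = (l1_space \<Gamma> :: (complex, 'g \<Rightarrow> complex) normed_module) in
           \<exists>y. (\<forall>n. y n \<in> unit_sphere (dual_space E)) \<and> weakly_null (dual_space E) y \<and>
               \<not> has_strongly_normal_subseq E y)) \<and>
     \<not> (\<forall>E :: (real, nat set \<Rightarrow> real) normed_module. banach_space E \<and> infinite_dimensional E \<longrightarrow>
          (\<forall>y. normal_seq E y \<longrightarrow> has_strongly_normal_subseq E y)) \<and>
     \<not> (\<forall>E :: (complex, nat set \<Rightarrow> complex) normed_module. banach_space E \<and> infinite_dimensional E \<longrightarrow>
          (\<forall>y. normal_seq E y \<longrightarrow> has_strongly_normal_subseq E y)) \<and>
     \<not> (\<forall>E :: (real, nat set \<Rightarrow> real) normed_module. banach_space E \<and> infinite_dimensional E \<longrightarrow>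
          (\<forall>y. normal_seq E y \<and> weakly_null (dual_space E) y \<longrightarrow> has_strongly_normal_subseq E y)) \<and>
     \<not> (\<forall>E :: (complex, nat set \<Rightarrow> complex) normed_module. banach_space E \<and> infinite_dimensional E \<longrightarrow>
          (\<forall>y. normal_seq E y \<and> weakly_null (dual_space E) y \<longrightarrow> has_strongly_normal_subseq E y))"
  using weakly_null_without_strongly_normal_subseq[where 'g = 'g and 'k = real]
    weakly_null_without_strongly_normal_subseq[where 'g = 'g and 'k = complex]
    banach_space_without_strongly_normal_subseq[where 'k = real]
    banach_space_without_strongly_normal_subseq[where 'k = complex]
  unfolding Let_def by blast

end
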